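(* Let $\mathcal{H}$ be a complex Hilbert space with a countable orthonormal basis $\vec{e}_1,\vec{e}_2,\ldots$, and let $L,M$ be bounded linear operators on $\mathcal{H}$ that are diagonal with respect to this basis: $L\vec{e}_i=\lambda_i\vec{e}_i$ and $M\vec{e}_i=\mu_i\vec{e}_i$ for all $i\geq 1$, with $\lambda_i,\mu_i\in\mathbb{C}$. Then $$(\sqrt{2}-1)\,\|L\|\,\|M\|\leq\|L\odot M\|\leq\|L\|\,\|M\|,$$ and these inequalities are sharp (that is, each holds with equality for some choice of $\mathcal{H}$ and of nonzero $L,M$ of this kind).
   Context: Let $\mathcal{H}\otimes\mathcal{H}$ be the Hilbert-space tensor product and let $\hat\pi$ be the unitary flip on it, determined by $\hat\pi(\vec{u}\otimes\vec{v})=\vec{v}\otimes\vec{u}$. The symmetric tensor power is the closed subspace $\mathcal{H}\odot\mathcal{H}=\{\vec{x}\in\mathcal{H}\otimes\mathcal{H}:\hat\pi\vec{x}=\vec{x}\}$. For bounded operators $A,B$ on $\mathcal{H}$, $A\otimes B$ is the bounded operator on $\mathcal{H}\otimes\mathcal{H}$ with $(A\otimes B)(\vec{u}\otimes\vec{v})=A\vec{u}\otimes B\vec{v}$, and the symmetric tensor product $A\odot B$ is the restriction of $\frac{1}{2}(A\otimes B+B\otimes A)$ to $\mathcal{H}\odot\mathcal{H}$, which is invariant under it, regarded as an operator on $\mathcal{H}\odot\mathcal{H}$. Finite-dimensional $\mathcal{H}$ is allowed. *)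

theory Defs
  imports "HOL-Analysis.Analysis"
begin

text \<open>Complex Hilbert spaces. The real structure (\<^const>\<open>scaleR\<close>, \<^const>\<open>inner\<close>, norm, metric) is
  inherited from the library and tied to the complex one by \<open>scaleR_scaleC\<close> and \<open>inner_cinner\<close>;
  positive definiteness and completeness come from the superclasses. The complex inner product is
  linear in its first argument.\<close>

class complex_hilbert = real_inner + complete_space +
  fixes scaleC :: "complex \<Rightarrow> 'a \<Rightarrow> 'a" (infixr \<open>*\<^sub>C\<close> 75)
    and cinner :: "'a \<Rightarrow> 'a \<Rightarrow> complex"
  assumes scaleC_add_right: "c *\<^sub>C (x + y) = c *\<^sub>C x + c *\<^sub>C y"
    and scaleC_add_left: "(c + d) *\<^sub>C x = c *\<^sub>C x + d *\<^sub>C x"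
    and scaleC_scaleC: "c *\<^sub>C d *\<^sub>C x = (c * d) *\<^sub>C x"
    and scaleR_scaleC: "r *\<^sub>R x = complex_of_real r *\<^sub>C x"
    and cinner_commute: "cinner x y = cnj (cinner y x)"
    and cinner_add_left: "cinner (x + y) z = cinner x z + cinner y z"
    and cinner_scaleC_left: "cinner (c *\<^sub>C x) y = c * cinner x y"
    and inner_cinner: "inner x y = Re (cinner x y)"

global_interpretation complex_space: vector_space "scaleC :: complex \<Rightarrow> 'a \<Rightarrow> 'a::complex_hilbert"
  defines cspan = complex_space.span
proof
  show "1 *\<^sub>C x = x" for x :: 'a
    using scaleR_scaleC[of 1 x] by simp
qed (simp_all add: scaleC_add_right scaleC_add_left scaleC_scaleC)

instantiation complex :: complex_hilbert
begin

definition scaleC_complex :: "complex \<Rightarrow> complex \<Rightarrow> complex"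
  where "scaleC_complex c x = c * x"

definition cinner_complex :: "complex \<Rightarrow> complex \<Rightarrow> complex"
  where "cinner_complex x y = x * cnj y"

instance
  by standard
    (auto simp: scaleC_complex_def cinner_complex_def scaleR_conv_of_real inner_complex_def
      algebra_simps)

end

instantiation vec :: (complex_hilbert, finite) complex_hilbert
begin

definition scaleC_vec :: "complex \<Rightarrow> 'a ^ 'b \<Rightarrow> 'a ^ 'b"
  where "scaleC_vec c x = (\<chi> i. c *\<^sub>C (x $ i))"

definition cinner_vec :: "'a ^ 'b \<Rightarrow> 'a ^ 'b \<Rightarrow> complex"
  where "cinner_vec x y = (\<Sum>i\<in>UNIV. cinner (x $ i) (y $ i))"

instance
proof
  fix x y :: "'a ^ 'b"
  show "cinner x y = cnj (cinner y x)"
    unfolding cinner_vec_def cnj_sum by (intro sum.cong refl cinner_commute)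
qed (auto simp: vec_eq_iff scaleC_vec_def cinner_vec_def inner_vec_def scaleC_add_right
      scaleC_add_left scaleC_scaleC scaleR_scaleC cinner_add_left cinner_scaleC_left inner_cinner
      sum.distrib sum_distrib_left)

end

definition bounded_clinear :: "('a::complex_hilbert \<Rightarrow> 'b::complex_hilbert) \<Rightarrow> bool"
  where "bounded_clinear f \<longleftrightarrow> bounded_linear f \<and> (\<forall>c x. f (c *\<^sub>C x) = c *\<^sub>C f x)"

definition unitary :: "('a::complex_hilbert \<Rightarrow> 'b::complex_hilbert) \<Rightarrow> bool"
  where "unitary U \<longleftrightarrow> bounded_clinear U \<and> surj U \<and> (\<forall>x y. cinner (U x) (U y) = cinner x y)"

text \<open>The basis \<open>e\<^sub>1, e\<^sub>2, \<dots>\<close> is either an infinite sequence or a finite list; \<open>I\<close> is its index set,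
  and values of \<open>e\<close> outside \<open>I\<close> are irrelevant.\<close>

definition countable_onb :: "nat set \<Rightarrow> (nat \<Rightarrow> 'a::complex_hilbert) \<Rightarrow> bool"
  where "countable_onb I e \<longleftrightarrow>
    (I = {1..} \<or> (\<exists>n. I = {1..n})) \<and>
    (\<forall>i\<in>I. \<forall>j\<in>I. cinner (e i) (e j) = (if i = j then 1 else 0)) \<and>
    closure (cspan (e ` I)) = UNIV"

definition diagonal_op ::
    "nat set \<Rightarrow> (nat \<Rightarrow> 'a::complex_hilbert) \<Rightarrow> (nat \<Rightarrow> complex) \<Rightarrow> ('a \<Rightarrow> 'a) \<Rightarrow> bool"
  where "diagonal_op I e l L \<longleftrightarrow> bounded_clinear L \<and> (\<forall>i\<in>I. L (e i) = l i *\<^sub>C e i)"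

text \<open>\<open>hilbert_tensor t\<close>: the Hilbert space \<open>'k\<close>, with \<open>t u v\<close> as the elementary tensor of \<open>u\<close> and \<open>v\<close>,
  is a Hilbert-space tensor product of \<open>'a\<close> with itself. This determines \<open>'k\<close> and \<open>t\<close> up to a unique
  unitary isomorphism: it says that \<open>'k\<close> is the completion of the algebraic tensor product
  (the span of the elementary tensors) with respect to the product inner product.\<close>

definition hilbert_tensor :: "('a::complex_hilbert \<Rightarrow> 'a \<Rightarrow> 'k::complex_hilbert) \<Rightarrow> bool"
  where "hilbert_tensor t \<longleftrightarrow>
    (\<forall>u u' v. t (u + u') v = t u v + t u' v) \<and>
    (\<forall>u v v'. t u (v + v') = t u v + t u v') \<and>
    (\<forall>c u v. t (c *\<^sub>C u) v = c *\<^sub>C t u v \<and> t u (c *\<^sub>C v) = c *\<^sub>C t u v) \<and>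
    (\<forall>u v u' v'. cinner (t u v) (t u' v') = cinner u u' * cinner v v') \<and>
    closure (cspan {t u v | u v. True}) = UNIV"

definition tensor_flip :: "('a::complex_hilbert \<Rightarrow> 'a \<Rightarrow> 'k::complex_hilbert) \<Rightarrow> 'k \<Rightarrow> 'k"
  where "tensor_flip t = (THE P. unitary P \<and> (\<forall>u v. P (t u v) = t v u))"

definition sym_power :: "('a::complex_hilbert \<Rightarrow> 'a \<Rightarrow> 'k::complex_hilbert) \<Rightarrow> 'k set"
  where "sym_power t = {x. tensor_flip t x = x}"

definition tensor_op ::
    "('a::complex_hilbert \<Rightarrow> 'a \<Rightarrow> 'k::complex_hilbert) \<Rightarrow> ('a \<Rightarrow> 'a) \<Rightarrow> ('a \<Rightarrow> 'a) \<Rightarrow> 'k \<Rightarrow> 'k"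
  where "tensor_op t A B =
    (THE T. bounded_clinear T \<and> (\<forall>u v. T (t u v) = t (A u) (B v)))"

definition sym_tensor_op ::
    "('a::complex_hilbert \<Rightarrow> 'a \<Rightarrow> 'k::complex_hilbert) \<Rightarrow> ('a \<Rightarrow> 'a) \<Rightarrow> ('a \<Rightarrow> 'a) \<Rightarrow> 'k \<Rightarrow> 'k"
  where "sym_tensor_op t A B =
    (\<lambda>x\<in>sym_power t. (1/2) *\<^sub>C (tensor_op t A B x + tensor_op t B A x))"

text \<open>Operator norm of an operator whose domain is the subspace \<open>S\<close>; for \<open>S = UNIV\<close> this is the
  library's \<^const>\<open>onorm\<close>.\<close>

definition onorm_on :: "'a::real_normed_vector set \<Rightarrow> ('a \<Rightarrow> 'b::real_normed_vector) \<Rightarrow> real"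
  where "onorm_on S f = (SUP x\<in>S. norm (f x) / norm x)"

end

theory Submission
  imports Defs
begin

text \<open>The vectors \<open>e\<^sub>i \<otimes> e\<^sub>j\<close> form an orthonormal basis of the tensor square, and
  \<open>(L \<otimes> M + M \<otimes> L) / 2\<close> is diagonal in it with eigenvalues \<open>(\<lambda>\<^sub>i \<mu>\<^sub>j + \<lambda>\<^sub>j \<mu>\<^sub>i) / 2\<close>. These are
  symmetric in \<open>i\<close> and \<open>j\<close>, so each is attained on the symmetric vector \<open>e\<^sub>i \<otimes> e\<^sub>j + e\<^sub>j \<otimes> e\<^sub>i\<close>, and
  the norm \<open>N\<close> of the symmetric product is the supremum of their moduli. The upper bound is immediate.
  For the lower one put \<open>s = \<bar>\<lambda>\<^sub>i \<mu>\<^sub>j\<bar>\<close> and \<open>r = \<bar>\<lambda>\<^sub>j \<mu>\<^sub>i\<bar>\<close>: the pairs \<open>(i, i)\<close> and \<open>(j, j)\<close> give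
  \<open>s r \<le> N\<^sup>2\<close>, the pair \<open>(i, j)\<close> gives \<open>s - r \<le> 2 N\<close>, hence \<open>2 s\<^sup>2 \<le> (N + s)\<^sup>2\<close>, that is
  \<open>(\<surd>2 - 1) s \<le> N\<close>. With \<open>c = \<surd>2 - 1\<close>, equality holds for \<open>L = diag(1, -c)\<close> and
  \<open>M = diag(c, 1)\<close>, since \<open>(1 - c\<^sup>2) / 2 = c\<close>.\<close>

subsection \<open>Bounded operators on an orthonormal basis\<close>

lemma cinner_scaleC_right: "cinner x (c *\<^sub>C y) = cnj c * cinner x y"
  by (metis cinner_commute cinner_scaleC_left complex_cnj_cnj complex_cnj_mult)

text \<open>Since \<open>Im z = - Re (i z)\<close>, the real inner product determines the complex
  one. This later turns preservation of \<open>inner\<close> into preservation of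
  \<open>cinner\<close>.\<close>

lemma cinner_Complex: "cinner x y = Complex (inner x y) (- inner (\<i> *\<^sub>C x) y)"
  by (simp add: inner_cinner cinner_scaleC_left complex_eq_iff)

lemma norm_scaleC: "norm (c *\<^sub>C x) = cmod c * norm (x :: 'a::complex_hilbert)"
proof -
  have "Im (cinner x x) = 0"
    using arg_cong[OF cinner_commute[of x x], of Im] by simp
  then have "inner (c *\<^sub>C x) (c *\<^sub>C x) = (cmod c)\<^sup>2 * inner x x"
    unfolding inner_cinner
    by (simp add: cinner_scaleC_left cinner_scaleC_right cmod_power2)
      (simp add: algebra_simps power2_eq_square)
  then show ?thesis
    by (simp add: norm_eq_sqrt_inner real_sqrt_mult)
qed

text \<open>Pythagoras: complex orthogonality survives scaling and implies real orthogonality. The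
  \<open>g i\<close> are not normalised because images of basis vectors may have any length,
  including zero.\<close>

lemma norm_sum_orthogonal_square:
  fixes g :: "'i \<Rightarrow> 'a::complex_hilbert"
  assumes "finite F" and "\<And>i j. i \<in> F \<Longrightarrow> j \<in> F \<Longrightarrow> i \<noteq> j \<Longrightarrow> cinner (g i) (g j) = 0"
  shows "(norm (\<Sum>i\<in>F. c i *\<^sub>C g i))\<^sup>2 = (\<Sum>i\<in>F. (cmod (c i))\<^sup>2 * (norm (g i))\<^sup>2)"
proof -
  have "pairwise (\<lambda>i j. orthogonal (c i *\<^sub>C g i) (c j *\<^sub>C g j)) F"
    using assms(2)
    by (auto simp: pairwise_def orthogonal_def inner_cinner cinner_scaleC_left cinner_scaleC_right)
  then show ?thesis
    by (simp add: norm_sum_Pythagorean[OF assms(1)] norm_scaleC power_mult_distrib)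
qed

lemma bounded_clinearD:
  assumes "bounded_clinear T"
  shows "T (x + y) = T x + T y" "T (c *\<^sub>C x) = c *\<^sub>C T x" "continuous_on A T"
    "Vector_Spaces.linear scaleC scaleC T"
proof -
  interpret bounded_linear T
    using assms by (simp add: bounded_clinear_def)
  show "T (x + y) = T x + T y"
    by (rule add)
  show *: "T (c *\<^sub>C x) = c *\<^sub>C T x" for c x
    using assms by (simp add: bounded_clinear_def)
  show "continuous_on A T"
    by (rule linear_continuous_on) unfold_locales
  show "Vector_Spaces.linear scaleC scaleC T"
    by unfold_locales (simp_all add: add *)
qed

lemma bounded_clinearI:
  assumes "\<And>x y. T (x + y) = T x + T y" "\<And>c x. T (c *\<^sub>C x) = c *\<^sub>C T x"
    and "\<And>x. norm (T x) \<le> C * norm x"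
  shows "bounded_clinear T"
  unfolding bounded_clinear_def
  by (auto intro!: bounded_linear_intro[of _ C] simp: assms scaleR_scaleC)
    (metis assms(3) mult.commute)

lemma bounded_clinear_scaleC: "bounded_clinear (\<lambda>x. c *\<^sub>C x)"
  by (rule bounded_clinearI[of _ "cmod c"])
    (simp_all add: scaleC_add_right scaleC_scaleC norm_scaleC mult.commute)

section \<open>Density arguments: uniqueness and extension of bounded operators\<close>

lemma dense_induct:
  assumes "closure S = UNIV" "closed {x. P x}" "\<And>x. x \<in> S \<Longrightarrow> P x"
  shows "P x"
  using closure_minimal[of S "{x. P x}"] assms by auto

text \<open>Agreement spreads from \<open>A\<close> to its span by linearity and to the closure by
  continuity.\<close>

lemma bounded_clinear_eqI:
  fixes S T :: "'a::complex_hilbert \<Rightarrow> 'b::complex_hilbert"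
  assumes "bounded_clinear S" "bounded_clinear T" "closure (cspan A) = UNIV"
    and "\<And>x. x \<in> A \<Longrightarrow> S x = T x"
  shows "S = T"
proof
  fix x
  show "S x = T x"
  proof (rule dense_induct[OF assms(3)])
    show "closed {x. S x = T x}"
      by (intro closed_Collect_eq bounded_clinearD(3) assms)
    show "S x = T x" if "x \<in> cspan A" for x
    proof -
      interpret vector_space_pair "scaleC :: _ \<Rightarrow> 'a \<Rightarrow> 'a" "scaleC :: _ \<Rightarrow> 'b \<Rightarrow> 'b" ..
      show ?thesis
        by (rule linear_eq_on[OF bounded_clinearD(4) bounded_clinearD(4) that[unfolded cspan_def]])
          (use assms in auto)
    qed
  qed
qed

text \<open>The bound makes \<open>T0\<close> Lipschitz on the dense span, so completeness of the
  target yields a continuous extension. Linearity and the bound are closed conditions and pass to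
  the limit.\<close>

lemma clinear_dense_extension:
  fixes T0 :: "'a::complex_hilbert \<Rightarrow> 'b::complex_hilbert"
  assumes lin: "Vector_Spaces.linear scaleC scaleC T0"
    and dense: "closure (cspan B) = UNIV"
    and bound: "\<And>x. x \<in> cspan B \<Longrightarrow> norm (T0 x) \<le> C * norm x" and "0 \<le> C"
  obtains T where "bounded_clinear T" "\<And>x. x \<in> cspan B \<Longrightarrow> T x = T0 x"
    "\<And>x. norm (T x) \<le> C * norm x"
proof -
  interpret T0: Vector_Spaces.linear scaleC scaleC T0 by (rule lin)
  have "C-lipschitz_on (cspan B) T0"
    using bound[OF complex_space.span_diff] \<open>0 \<le> C\<close>
    by (intro lipschitz_onI) (auto simp: dist_norm T0.diff[symmetric])
  then have "uniformly_continuous_on (cspan B) T0"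
    by (rule lipschitz_on_uniformly_continuous)
  then obtain T where "uniformly_continuous_on UNIV T" and T: "\<And>x. x \<in> cspan B \<Longrightarrow> T0 x = T x"
    using uniformly_continuous_on_extension_on_closure dense by metis
  then have [continuous_intros]: "continuous_on A (\<lambda>x. T (h x))"
    if "continuous_on A h" for A :: "'a set" and h
    using that continuous_on_compose2[OF uniformly_continuous_imp_continuous] by blast
  have [continuous_intros]: "continuous_on A (\<lambda>x. c *\<^sub>C h x)"
    if "continuous_on A h" for c and A :: "'a set" and h :: "'a \<Rightarrow> 'x::complex_hilbert"
    using continuous_on_compose2[OF bounded_clinearD(3)[OF bounded_clinear_scaleC] that] by blast
  \<comment> \<open>Density is used in one argument at a time; here the second one stays in the
    span.\<close>
  have add1: "T (x + y) = T x + T y" if "y \<in> cspan B" for x y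
  proof (rule dense_induct[OF dense, of "\<lambda>x. T (x + y) = T x + T y"])
    show "closed {x. T (x + y) = T x + T y}"
      by (intro closed_Collect_eq continuous_intros)
  qed (simp add: T[symmetric] that complex_space.span_add T0.add)
  have add: "T (x + y) = T x + T y" for x y
  proof (rule dense_induct[OF dense, of "\<lambda>y. T (x + y) = T x + T y"])
    show "closed {y. T (x + y) = T x + T y}"
      by (intro closed_Collect_eq continuous_intros)
  qed (rule add1)
  have scale: "T (c *\<^sub>C x) = c *\<^sub>C T x" for c x
  proof (rule dense_induct[OF dense, of "\<lambda>x. T (c *\<^sub>C x) = c *\<^sub>C T x"])
    show "closed {x. T (c *\<^sub>C x) = c *\<^sub>C T x}"
      by (intro closed_Collect_eq continuous_intros)
  qed (simp add: T[symmetric] complex_space.span_scale T0.scale)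
  have norm: "norm (T x) \<le> C * norm x" for x
  proof (rule dense_induct[OF dense, of "\<lambda>x. norm (T x) \<le> C * norm x"])
    show "closed {x. norm (T x) \<le> C * norm x}"
      by (intro closed_Collect_le continuous_intros)
  qed (simp add: T[symmetric] bound)
  show thesis
    by (rule that[OF bounded_clinearI[OF add scale norm] _ norm]) (simp add: T)
qed

text \<open>The index type is arbitrary, so that pairs of indices can label the basis of the tensor
  square without an enumeration.\<close>

definition onb :: "'i set \<Rightarrow> ('i \<Rightarrow> 'a::complex_hilbert) \<Rightarrow> bool"
  where "onb J f \<longleftrightarrow> (\<forall>i\<in>J. \<forall>j\<in>J. cinner (f i) (f j) = (if i = j then 1 else 0)) \<and>
    closure (cspan (f ` J)) = UNIV"

lemma onb_norm:
  assumes "onb J f" "i \<in> J"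
  shows "norm (f i) = 1"
  using assms by (simp add: onb_def norm_eq_sqrt_inner inner_cinner)

lemma onb_inj_on:
  assumes "onb J f"
  shows "inj_on f J"
  using assms by (intro inj_onI) (metis onb_def zero_neq_one)

lemma onb_norm_sum:
  assumes "onb J f" "finite F" "F \<subseteq> J"
  shows "(norm (\<Sum>i\<in>F. c i *\<^sub>C f i))\<^sup>2 = (\<Sum>i\<in>F. (cmod (c i))\<^sup>2)"
proof -
  have "(norm (\<Sum>i\<in>F. c i *\<^sub>C f i))\<^sup>2 = (\<Sum>i\<in>F. (cmod (c i))\<^sup>2 * (norm (f i))\<^sup>2)"
    using assms by (intro norm_sum_orthogonal_square) (auto simp: onb_def subset_eq)
  also have "\<dots> = (\<Sum>i\<in>F. (cmod (c i))\<^sup>2)"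
    using assms by (intro sum.cong) (auto simp: onb_norm subset_eq)
  finally show ?thesis .
qed

text \<open>The squared norm of a finite combination is the sum of the squared moduli of its
  coefficients, so a vanishing combination has only zero coefficients.\<close>

lemma onb_independent:
  fixes f :: "'i \<Rightarrow> 'a::complex_hilbert"
  assumes "onb J f"
  shows "complex_space.independent (f ` J)"
  unfolding complex_space.independent_explicit_module
proof (intro allI impI)
  fix A u and v :: 'a
  assume A: "finite A" "A \<subseteq> f ` J" "(\<Sum>v\<in>A. u v *\<^sub>C v) = 0" "v \<in> A"
  obtain F where F: "F \<subseteq> J" "A = f ` F" "finite F"
    using finite_subset_image[OF A(1,2)] by blast
  have inj: "inj_on f F"
    using onb_inj_on[OF assms] F inj_on_subset by blast
  have "(\<Sum>i\<in>F. (cmod (u (f i)))\<^sup>2) = (norm (\<Sum>i\<in>F. u (f i) *\<^sub>C f i))\<^sup>2"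
    using onb_norm_sum[OF assms] F by simp
  also have "\<dots> = 0"
    using A(3) by (simp add: F sum.reindex[OF inj])
  finally show "u v = 0"
    using F A by (auto simp: sum_nonneg_eq_0_iff)
qed

text \<open>Orthogonality of the images lets Pythagoras bound the map on finite combinations by
  \<open>C\<close>, whence it extends. The flip and the tensor products of diagonal operators are
  both built this way.\<close>

lemma onb_extension:
  fixes f :: "'i \<Rightarrow> 'a::complex_hilbert" and g :: "'i \<Rightarrow> 'b::complex_hilbert"
  assumes f: "onb J f"
    and orth: "\<And>i j. i \<in> J \<Longrightarrow> j \<in> J \<Longrightarrow> i \<noteq> j \<Longrightarrow> cinner (g i) (g j) = 0"
    and bound: "\<And>i. i \<in> J \<Longrightarrow> norm (g i) \<le> C" and "0 \<le> C"
  obtains T where "bounded_clinear T" "\<And>i. i \<in> J \<Longrightarrow> T (f i) = g i"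
    "\<And>x. norm (T x) \<le> C * norm x"
proof -
  interpret vector_space_pair "scaleC :: _ \<Rightarrow> 'a \<Rightarrow> 'a" "scaleC :: _ \<Rightarrow> 'b \<Rightarrow> 'b" ..
  \<comment> \<open>\<open>construct\<close> expects a function of the basis vector, so the index is
    recovered by inverting \<open>f\<close>.\<close>
  define T0 where "T0 = construct (f ` J) (\<lambda>x. g (inv_into J f x))"
  interpret T0: Vector_Spaces.linear scaleC scaleC T0
    unfolding T0_def by (rule linear_construct[OF onb_independent[OF f]])
  have T0f: "T0 (f i) = g i" if "i \<in> J" for i
    using that onb_inj_on[OF f]
    by (simp add: T0_def construct_basis[OF onb_independent[OF f]])
  have "norm (T0 x) \<le> C * norm x" if "x \<in> cspan (f ` J)" for x
  proof -
    obtain A u where A: "finite A" "A \<subseteq> f ` J" "x = (\<Sum>v\<in>A. u v *\<^sub>C v)"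
      using \<open>x \<in> cspan (f ` J)\<close> unfolding complex_space.span_explicit by auto
    obtain F where F: "F \<subseteq> J" "A = f ` F" "finite F"
      using finite_subset_image[OF A(1,2)] by blast
    have inj: "inj_on f F"
      using onb_inj_on[OF f] F inj_on_subset by blast
    have x: "x = (\<Sum>i\<in>F. u (f i) *\<^sub>C f i)"
      by (simp add: A F sum.reindex[OF inj])
    have "T0 x = (\<Sum>i\<in>F. u (f i) *\<^sub>C g i)"
      unfolding x T0.sum using F by (intro sum.cong) (auto simp: T0.scale T0f subset_eq)
    then have "(norm (T0 x))\<^sup>2 = (\<Sum>i\<in>F. (cmod (u (f i)))\<^sup>2 * (norm (g i))\<^sup>2)"
      using F orth by (simp add: norm_sum_orthogonal_square subset_eq)
    also have "\<dots> \<le> (\<Sum>i\<in>F. (cmod (u (f i)))\<^sup>2 * C\<^sup>2)"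
      using F bound by (intro sum_mono mult_left_mono power_mono) auto
    also have "\<dots> = (C * norm x)\<^sup>2"
      using F by (subst mult.commute) (simp add: x onb_norm_sum[OF f] power_mult_distrib sum_distrib_right)
    finally show ?thesis
      by (rule power2_le_imp_le) (use \<open>0 \<le> C\<close> in simp)
  qed
  from clinear_dense_extension[OF T0.linear_axioms _ this \<open>0 \<le> C\<close>] f
  obtain T where T: "bounded_clinear T" "\<And>x. x \<in> cspan (f ` J) \<Longrightarrow> T x = T0 x"
    "\<And>x. norm (T x) \<le> C * norm x"
    unfolding onb_def by blast
  show thesis
    by (rule that[OF T(1) _ T(3)]) (simp add: T(2) T0f complex_space.span_base)
qed

text \<open>The extension lemma supplies an operator with the same eigenvalues that satisfies the
  bound; it agrees with \<open>D\<close> on the basis and hence equals \<open>D\<close>.\<close>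

lemma diagonal_norm_le:
  assumes f: "onb J f" and D: "bounded_clinear D" "\<And>i. i \<in> J \<Longrightarrow> D (f i) = d i *\<^sub>C f i"
    and bound: "\<And>i. i \<in> J \<Longrightarrow> cmod (d i) \<le> C" and "0 \<le> C"
  shows "norm (D x) \<le> C * norm x"
proof -
  have "norm (d i *\<^sub>C f i) \<le> C" if "i \<in> J" for i
    using that bound by (simp add: norm_scaleC onb_norm[OF f])
  moreover have "cinner (d i *\<^sub>C f i) (d j *\<^sub>C f j) = 0" if "i \<in> J" "j \<in> J" "i \<noteq> j" for i j
    using f that by (simp add: onb_def cinner_scaleC_left cinner_scaleC_right)
  ultimately obtain T where T: "bounded_clinear T" "\<And>i. i \<in> J \<Longrightarrow> T (f i) = d i *\<^sub>C f i"
    "\<And>x. norm (T x) \<le> C * norm x"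
    using onb_extension[OF f _ _ \<open>0 \<le> C\<close>, of "\<lambda>i. d i *\<^sub>C f i"] by metis
  have "D = T"
    by (rule bounded_clinear_eqI[of _ _ "f ` J"]) (use D T f in \<open>auto simp: onb_def\<close>)
  then show ?thesis
    by (simp add: T)
qed

section \<open>Closure properties, unitarity and operator norms\<close>

lemma bounded_clinear_compose:
  "bounded_clinear S \<Longrightarrow> bounded_clinear T \<Longrightarrow> bounded_clinear (\<lambda>x. S (T x))"
  unfolding bounded_clinear_def by (auto intro: bounded_linear_compose)

lemma bounded_clinear_add:
  "bounded_clinear S \<Longrightarrow> bounded_clinear T \<Longrightarrow> bounded_clinear (\<lambda>x. S x + T x)"
  unfolding bounded_clinear_def by (auto intro: bounded_linear_add simp: scaleC_add_right)

lemma bounded_clinear_ident: "bounded_clinear (\<lambda>x. x)"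
  by (simp add: bounded_clinear_def bounded_linear_ident)

lemma subspace_closure_cspan: "complex_space.subspace (closure (cspan A))"
proof (rule complex_space.subspaceI)
  show "0 \<in> closure (cspan A)"
    using closure_subset complex_space.span_zero by blast
  show "x + y \<in> closure (cspan A)" if "x \<in> closure (cspan A)" "y \<in> closure (cspan A)" for x y
  proof -
    obtain X where "\<forall>n. X n \<in> cspan A" "X \<longlonglongrightarrow> x"
      using \<open>x \<in> _\<close> unfolding closure_sequential by blast
    moreover obtain Y where "\<forall>n. Y n \<in> cspan A" "Y \<longlonglongrightarrow> y"
      using \<open>y \<in> _\<close> unfolding closure_sequential by blast
    ultimately show ?thesis
      unfolding closure_sequential
      by (intro exI[of _ "\<lambda>n. X n + Y n"]) (auto intro: tendsto_add complex_space.span_add)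
  qed
  show "c *\<^sub>C x \<in> closure (cspan A)" if "x \<in> closure (cspan A)" for c x
  proof -
    have "(\<lambda>x. c *\<^sub>C x) ` closure (cspan A) \<subseteq> closure (cspan A)"
      using closure_subset[of "cspan A"]
      by (intro image_closure_subset bounded_clinearD(3) bounded_clinear_scaleC)
        (auto simp: complex_space.span_scale)
    then show ?thesis
      using that by blast
  qed
qed

lemma onb_cinner:
  "onb J f \<Longrightarrow> i \<in> J \<Longrightarrow> j \<in> J \<Longrightarrow> cinner (f i) (f j) = (if i = j then 1 else 0)"
  by (simp add: onb_def)

text \<open>Polarization recovers the real inner product from the norm; applying this to
  \<open>i x\<close> as well gives the imaginary part of the complex one.\<close>

lemma isometric_surj_unitary:
  assumes P: "bounded_clinear P" "surj P" "\<And>x. norm (P x) = norm x"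
  shows "unitary P"
proof -
  have *: "inner (P x) (P y) = inner x y" for x y
    using P(3)[of "x + y"] P(3)[of x] P(3)[of y] by (simp add: dot_norm bounded_clinearD(1)[OF P(1)])
  then have "cinner (P x) (P y) = cinner x y" for x y
    unfolding cinner_Complex bounded_clinearD(2)[OF P(1), symmetric] by simp
  then show ?thesis
    using P by (simp add: unitary_def)
qed

lemma diagonal_onorm_le:
  assumes "onb J f" "bounded_clinear D" "\<And>i. i \<in> J \<Longrightarrow> D (f i) = d i *\<^sub>C f i"
    and "\<And>i. i \<in> J \<Longrightarrow> cmod (d i) \<le> C" and "0 \<le> C"
  shows "onorm D \<le> C"
  using \<open>0 \<le> C\<close> diagonal_norm_le[OF assms] by (rule onorm_bound)

lemma diagonal_onorm_ge:
  assumes "onb J f" "bounded_clinear D" "D (f i) = d *\<^sub>C f i" "i \<in> J"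
  shows "cmod d \<le> onorm D"
  using onorm[of D "f i"] assms onb_norm[OF assms(1,4)]
  by (simp add: bounded_clinear_def norm_scaleC)

subsection \<open>Symmetric products of diagonal operators\<close>

locale onb_tensor =
  fixes t :: "'a::complex_hilbert \<Rightarrow> 'a \<Rightarrow> 'k::complex_hilbert" and I :: "'i set" and e :: "'i \<Rightarrow> 'a"
  assumes tensor: "hilbert_tensor t" and onb: "onb I e"
begin

section \<open>Elementary tensors and the product basis\<close>

lemma cinner_t: "cinner (t u v) (t u' v') = cinner u u' * cinner v v'"
  using tensor by (simp add: hilbert_tensor_def)

lemma norm_t: "norm (t u v) = norm u * norm v"
proof -
  have "Im (cinner u u) = 0"
    using arg_cong[OF cinner_commute[of u u], of Im] by simp
  then have "inner (t u v) (t u v) = inner u u * inner v v"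
    by (simp add: inner_cinner cinner_t)
  then show ?thesis
    by (simp add: norm_eq_sqrt_inner real_sqrt_mult)
qed

lemma bounded_clinear_t_left: "bounded_clinear (\<lambda>u. t u v)"
  using tensor by (intro bounded_clinearI[of _ "norm v"]) (auto simp: hilbert_tensor_def norm_t)

lemma bounded_clinear_t_right: "bounded_clinear (\<lambda>v. t u v)"
  using tensor by (intro bounded_clinearI[of _ "norm u"]) (auto simp: hilbert_tensor_def norm_t)

lemma onb_eqI:
  assumes "bounded_clinear S" "bounded_clinear T" "\<And>i. i \<in> I \<Longrightarrow> S (e i) = T (e i)"
  shows "S = T"
  by (rule bounded_clinear_eqI[of _ _ "e ` I"]) (use assms onb in \<open>auto simp: onb_def\<close>)

text \<open>Equality is extended in the first argument with a basis vector fixed in the second, and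
  then in the second argument.\<close>

lemma bilinear_eqI:
  assumes "\<And>v. bounded_clinear (\<lambda>u. S u v)" "\<And>u. bounded_clinear (\<lambda>v. S u v)"
    and "\<And>v. bounded_clinear (\<lambda>u. T u v)" "\<And>u. bounded_clinear (\<lambda>v. T u v)"
    and "\<And>i j. i \<in> I \<Longrightarrow> j \<in> I \<Longrightarrow> S (e i) (e j) = T (e i) (e j)"
  shows "S u v = T u v"
proof -
  have "(\<lambda>u. S u (e j)) = (\<lambda>u. T u (e j))" if "j \<in> I" for j
    by (rule onb_eqI) (use assms that in auto)
  then have "(\<lambda>v. S u v) = (\<lambda>v. T u v)"
    by (intro onb_eqI) (auto intro: assms dest: fun_cong)
  then show ?thesis
    by (rule fun_cong)
qed

text \<open>The uniqueness half of the definite descriptions \<open>tensor_flip\<close> and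
  \<open>tensor_op\<close>.\<close>

lemma tensor_eqI:
  assumes "bounded_clinear S" "bounded_clinear T" "\<And>u v. S (t u v) = T (t u v)"
  shows "S = T"
  by (rule bounded_clinear_eqI[of _ _ "{t u v | u v. True}"])
    (use assms tensor in \<open>auto simp: hilbert_tensor_def\<close>)

abbreviation ee :: "'i \<times> 'i \<Rightarrow> 'k"
  where "ee \<equiv> \<lambda>(i, j). t (e i) (e j)"

text \<open>Orthonormality is immediate from \<open>cinner_t\<close>. For density, the closed span
  \<open>?C\<close> of the products of basis vectors absorbs first all \<open>t u (e j)\<close>,
  then all \<open>t u v\<close>, and these span a dense subspace.\<close>

lemma onb_t: "onb (I \<times> I) ee"
proof -
  let ?C = "closure (cspan (ee ` (I \<times> I)))"
  \<comment> \<open>The preimage of the closed subspace \<open>?C\<close> under a bounded operator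
    is a closed subspace, so it is everything once it contains the basis.\<close>
  have dense: "T x \<in> ?C" if T: "bounded_clinear T" and "\<And>i. i \<in> I \<Longrightarrow> T (e i) \<in> ?C"
    for T :: "'a \<Rightarrow> 'k" and x
  proof (rule dense_induct[of "cspan (e ` I)" "\<lambda>x. T x \<in> ?C"])
    show "closed {x. T x \<in> ?C}"
      using closed_vimage[of ?C T] bounded_clinearD(3)[OF T] by (simp add: vimage_def)
    have "complex_space.subspace {x. T x \<in> ?C}"
    proof (rule complex_space.subspaceI)
      have "T 0 = 0"
        using bounded_clinearD(2)[OF T, of 0 0] by simp
      then show "0 \<in> {x. T x \<in> ?C}"
        using complex_space.subspace_0[OF subspace_closure_cspan] by simp
    qed (simp_all add: bounded_clinearD(1,2)[OF T] complex_space.subspace_add[OF subspace_closure_cspan]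
        complex_space.subspace_scale[OF subspace_closure_cspan])
    then have "cspan (e ` I) \<subseteq> {x. T x \<in> ?C}"
      using that(2) by (intro complex_space.span_minimal) auto
    then show "T x \<in> ?C" if "x \<in> cspan (e ` I)" for x
      using that by auto
  qed (use onb in \<open>simp add: onb_def\<close>)
  have basis: "t (e i) (e j) \<in> ?C" if "i \<in> I" "j \<in> I" for i j
    by (rule subsetD[OF closure_subset], rule complex_space.span_base) (use that in force)
  have left: "t u (e j) \<in> ?C" if "j \<in> I" for u j
    by (rule dense[OF bounded_clinear_t_left]) (rule basis[OF _ that])
  have "t u v \<in> ?C" for u v
    by (rule dense[OF bounded_clinear_t_right left])
  then have "cspan {t u v | u v. True} \<subseteq> ?C"
    by (intro complex_space.span_minimal subspace_closure_cspan) auto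
  then have "closure (cspan {t u v | u v. True}) \<subseteq> ?C"
    by (rule closure_minimal) simp
  then have "?C = UNIV"
    using tensor by (auto simp: hilbert_tensor_def)
  then show ?thesis
    by (auto simp: onb_def cinner_t onb_cinner[OF onb])
qed

text \<open>Justifies the definite description: permuting the product basis extends to a contraction
  \<open>P\<close>, which is its own inverse and therefore a surjective isometry.\<close>

lemma tensor_flip_elementary:
  "bounded_clinear (tensor_flip t)" "tensor_flip t (t u v) = t v u"
proof -
  let ?Q = "\<lambda>P. unitary P \<and> (\<forall>u v. P (t u v) = t v u)"
  obtain P where P: "bounded_clinear P" "\<And>p. p \<in> I \<times> I \<Longrightarrow> P (ee p) = ee (prod.swap p)"
    "\<And>x. norm (P x) \<le> 1 * norm x"
  proof (rule onb_extension[OF onb_t, of "\<lambda>p. ee (prod.swap p)" 1])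
    show "cinner (ee (prod.swap p)) (ee (prod.swap q)) = 0"
      if "p \<in> I \<times> I" "q \<in> I \<times> I" "p \<noteq> q" for p q
      using that by (auto simp: cinner_t onb_cinner[OF onb] split: if_splits)
    show "norm (ee (prod.swap p)) \<le> 1" if "p \<in> I \<times> I" for p
      using that onb by (auto simp: norm_t onb_norm)
  qed auto
  have Pt: "P (t u v) = t v u" for u v
  proof (rule bilinear_eqI[of "\<lambda>u v. P (t u v)" "\<lambda>u v. t v u"])
    show "P (t (e i) (e j)) = t (e j) (e i)" if "i \<in> I" "j \<in> I" for i j
      using P(2)[of "(i, j)"] that by simp
  qed (rule bounded_clinear_compose[OF P(1) bounded_clinear_t_left]
      bounded_clinear_compose[OF P(1) bounded_clinear_t_right]
      bounded_clinear_t_left bounded_clinear_t_right)+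
  have "(\<lambda>x. P (P x)) = (\<lambda>x. x)"
    by (rule tensor_eqI[OF bounded_clinear_compose[OF P(1) P(1)] bounded_clinear_ident]) (simp add: Pt)
  then have PP: "P (P x) = x" for x
    by (rule fun_cong)
  have "surj P"
    using PP by (rule surjI)
  \<comment> \<open>Contractivity at \<open>x\<close> and at \<open>P x\<close> gives the two
    inequalities.\<close>
  moreover have "norm (P x) = norm x" for x
    using P(3)[of x] P(3)[of "P x"] PP by simp
  ultimately have "?Q P"
    using P(1) Pt isometric_surj_unitary by blast
  moreover have "P' = P" if "?Q P'" for P'
    using that P(1) Pt by (intro tensor_eqI) (auto simp: unitary_def)
  ultimately have "?Q (tensor_flip t)"
    unfolding tensor_flip_def by (rule theI)
  then show "bounded_clinear (tensor_flip t)" "tensor_flip t (t u v) = t v u"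
    by (auto simp: unitary_def)
qed

text \<open>Diagonality keeps the images of the product basis orthogonal, so
  \<open>onb_extension\<close> provides the operator that the definite description requires.\<close>

lemma tensor_op_diagonal:
  assumes A: "bounded_clinear A" "\<And>i. i \<in> I \<Longrightarrow> A (e i) = a i *\<^sub>C e i"
    and B: "bounded_clinear B" "\<And>i. i \<in> I \<Longrightarrow> B (e i) = b i *\<^sub>C e i"
  shows "bounded_clinear (tensor_op t A B)" "tensor_op t A B (t u v) = t (A u) (B v)"
proof -
  let ?Q = "\<lambda>T. bounded_clinear T \<and> (\<forall>u v. T (t u v) = t (A u) (B v))"
  have bl: "bounded_linear A" "bounded_linear B"
    using A B by (auto simp: bounded_clinear_def)
  obtain T where T: "bounded_clinear T"
    "\<And>p. p \<in> I \<times> I \<Longrightarrow> T (ee p) = t (A (e (fst p))) (B (e (snd p)))"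
  proof (rule onb_extension[OF onb_t,
        of "\<lambda>p. t (A (e (fst p))) (B (e (snd p)))" "onorm A * onorm B"])
    show "cinner (t (A (e (fst p))) (B (e (snd p)))) (t (A (e (fst q))) (B (e (snd q)))) = 0"
      if "p \<in> I \<times> I" "q \<in> I \<times> I" "p \<noteq> q" for p q
      using that
      by (auto simp: cinner_t onb_cinner[OF onb] A B cinner_scaleC_left cinner_scaleC_right split: if_splits)
    show "norm (t (A (e (fst p))) (B (e (snd p)))) \<le> onorm A * onorm B" if "p \<in> I \<times> I" for p
      using that onorm[OF bl(1), of "e (fst p)"] onorm[OF bl(2), of "e (snd p)"] onorm_pos_le[OF bl(1)]
      by (auto simp: norm_t onb_norm[OF onb] intro!: mult_mono)
    show "0 \<le> onorm A * onorm B"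
      using bl by (simp add: onorm_pos_le)
  qed auto
  have "T (t u v) = t (A u) (B v)" for u v
  proof (rule bilinear_eqI[of "\<lambda>u v. T (t u v)" "\<lambda>u v. t (A u) (B v)"])
    show "T (t (e i) (e j)) = t (A (e i)) (B (e j))" if "i \<in> I" "j \<in> I" for i j
      using T(2)[of "(i, j)"] that by simp
    show "bounded_clinear (\<lambda>u. t (A u) (B v))" for v
      by (rule bounded_clinear_compose[OF bounded_clinear_t_left A(1)])
    show "bounded_clinear (\<lambda>v. t (A u) (B v))" for u
      by (rule bounded_clinear_compose[OF bounded_clinear_t_right B(1)])
  qed (rule bounded_clinear_compose[OF T(1) bounded_clinear_t_left]
      bounded_clinear_compose[OF T(1) bounded_clinear_t_right]
      bounded_clinear_t_left bounded_clinear_t_right)+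
  then have "?Q T"
    using T(1) by blast
  moreover have "T' = T" if "?Q T'" for T'
    using that \<open>?Q T\<close> by (intro tensor_eqI) auto
  ultimately have "?Q (tensor_op t A B)"
    unfolding tensor_op_def by (rule theI)
  then show "bounded_clinear (tensor_op t A B)" "tensor_op t A B (t u v) = t (A u) (B v)"
    by auto
qed

end

section \<open>The norm of the symmetric product of two diagonal operators\<close>

locale diagonal_pair = onb_tensor +
  fixes L M :: "'a \<Rightarrow> 'a" and l m :: "'c \<Rightarrow> complex"
  assumes L: "bounded_clinear L" "\<And>i. i \<in> I \<Longrightarrow> L (e i) = l i *\<^sub>C e i"
    and M: "bounded_clinear M" "\<And>i. i \<in> I \<Longrightarrow> M (e i) = m i *\<^sub>C e i"
begin

text \<open>Taken on the whole tensor square, where the eigenvectors \<open>t (e i) (e j)\<close>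
  live; these need not be symmetric.\<close>

definition sym_op :: "'b \<Rightarrow> 'b"
  where "sym_op x = (1/2) *\<^sub>C (tensor_op t L M x + tensor_op t M L x)"

definition sym_ev :: "'c \<Rightarrow> 'c \<Rightarrow> complex"
  where "sym_ev i j = (l i * m j + l j * m i) / 2"

lemma bounded_clinear_sym_op: "bounded_clinear sym_op"
  unfolding sym_op_def[abs_def]
  by (intro bounded_clinear_compose[OF bounded_clinear_scaleC] bounded_clinear_add
      tensor_op_diagonal(1)[OF L M] tensor_op_diagonal(1)[OF M L])

lemma sym_op_basis:
  assumes "i \<in> I" "j \<in> I"
  shows "sym_op (t (e i) (e j)) = sym_ev i j *\<^sub>C t (e i) (e j)"
proof -
  have "sym_op (t (e i) (e j)) = (1/2) *\<^sub>C (t (l i *\<^sub>C e i) (m j *\<^sub>C e j) + t (m i *\<^sub>C e i) (l j *\<^sub>C e j))"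
    by (simp add: sym_op_def tensor_op_diagonal(2)[OF L M] tensor_op_diagonal(2)[OF M L] L M assms)
  also have "\<dots> = (1/2) *\<^sub>C ((l i * m j + m i * l j) *\<^sub>C t (e i) (e j))"
    by (simp add: bounded_clinearD(2)[OF bounded_clinear_t_left] scaleC_scaleC
        bounded_clinearD(2)[OF bounded_clinear_t_right] scaleC_add_left mult.commute)
  finally show ?thesis
    by (simp add: sym_ev_def scaleC_scaleC mult.commute)
qed

lemma norm_sym_op_le:
  assumes "\<And>i j. i \<in> I \<Longrightarrow> j \<in> I \<Longrightarrow> cmod (sym_ev i j) \<le> C" "0 \<le> C"
  shows "norm (sym_op x) \<le> C * norm x"
  by (rule diagonal_norm_le[OF onb_t bounded_clinear_sym_op, of "\<lambda>(i, j). sym_ev i j"])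
    (use assms sym_op_basis in auto)

lemma sym_tensor_op_eq: "x \<in> sym_power t \<Longrightarrow> sym_tensor_op t L M x = sym_op x"
  by (simp add: sym_tensor_op_def sym_op_def)

lemma zero_in_sym_power: "0 \<in> sym_power t"
  using bounded_clinearD(2)[OF tensor_flip_elementary(1), of 0 0] by (simp add: sym_power_def)

lemma sym_onorm_le:
  assumes "\<And>i j. i \<in> I \<Longrightarrow> j \<in> I \<Longrightarrow> cmod (sym_ev i j) \<le> C" "0 \<le> C"
  shows "onorm_on (sym_power t) (sym_tensor_op t L M) \<le> C"
  unfolding onorm_on_def
proof (rule cSUP_least)
  show "sym_power t \<noteq> {}"
    using zero_in_sym_power by blast
  \<comment> \<open>At \<open>x = 0\<close> the quotient is 0 by the convention for division by
    zero, which is where \<open>0 \<le> C\<close> enters.\<close>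
  show "norm (sym_tensor_op t L M x) / norm x \<le> C" if "x \<in> sym_power t" for x
    using norm_sym_op_le[OF assms, of x] \<open>0 \<le> C\<close>
    by (cases "x = 0") (simp_all add: sym_tensor_op_eq[OF that] divide_le_eq)
qed

text \<open>The quotients are bounded by the operator norm of \<open>sym_op\<close>, so the real
  supremum in \<open>onorm_on\<close> is a genuine upper bound.\<close>

lemma sym_onorm_quotient_le:
  assumes "x \<in> sym_power t"
  shows "norm (sym_op x) / norm x \<le> onorm_on (sym_power t) (sym_tensor_op t L M)"
proof -
  have bl: "bounded_linear sym_op"
    using bounded_clinear_sym_op by (simp add: bounded_clinear_def)
  have "bdd_above ((\<lambda>x. norm (sym_tensor_op t L M x) / norm x) ` sym_power t)"
    by (rule bdd_aboveI2[of _ _ "onorm sym_op"]) (simp add: sym_tensor_op_eq le_onorm[OF bl])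
  from cSUP_upper[OF assms this] show ?thesis
    by (simp add: onorm_on_def sym_tensor_op_eq[OF assms])
qed

text \<open>Both summands of the symmetrised vector \<open>w\<close> have the same eigenvalue, so
  \<open>w\<close> is an eigenvector inside the symmetric power.\<close>

lemma sym_onorm_ge:
  assumes "i \<in> I" "j \<in> I"
  shows "cmod (sym_ev i j) \<le> onorm_on (sym_power t) (sym_tensor_op t L M)"
proof -
  define w where "w = t (e i) (e j) + t (e j) (e i)"
  \<comment> \<open>The value is 2 if \<open>i = j\<close> and 1 otherwise, so \<open>w\<close> does
    not vanish in either case.\<close>
  have "cinner w (t (e i) (e j)) \<noteq> 0"
    using assms onb by (simp add: w_def cinner_add_left cinner_t onb_def)
  then have "w \<noteq> 0"
    using cinner_scaleC_left[of 0 0 "t (e i) (e j)"] by auto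
  have w: "w \<in> sym_power t"
    by (simp add: sym_power_def w_def bounded_clinearD(1)[OF tensor_flip_elementary(1)] tensor_flip_elementary(2) add.commute)
  have "sym_ev j i = sym_ev i j"
    by (simp add: sym_ev_def add.commute)
  then have "sym_op w = sym_ev i j *\<^sub>C w"
    by (simp add: w_def bounded_clinearD(1)[OF bounded_clinear_sym_op] sym_op_basis assms scaleC_add_right)
  then have "norm (sym_op w) / norm w = cmod (sym_ev i j)"
    using \<open>w \<noteq> 0\<close> by (simp add: norm_scaleC)
  with sym_onorm_quotient_le[OF w] show ?thesis
    by simp
qed

lemma sym_onorm_bounds:
  defines "N \<equiv> onorm_on (sym_power t) (sym_tensor_op t L M)"
  shows "(sqrt 2 - 1) * onorm L * onorm M \<le> N" "N \<le> onorm L * onorm M"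
proof -
  have pos: "0 \<le> onorm L" "0 \<le> onorm M"
    using L M by (auto simp: bounded_clinear_def onorm_pos_le)
  have le: "cmod (l i) \<le> onorm L" "cmod (m i) \<le> onorm M" if "i \<in> I" for i
    using diagonal_onorm_ge[OF onb] L M that by blast+
  show "N \<le> onorm L * onorm M"
    unfolding N_def
  proof (rule sym_onorm_le)
    show "cmod (sym_ev i j) \<le> onorm L * onorm M" if "i \<in> I" "j \<in> I" for i j
    proof -
      have "cmod (l i * m j) \<le> onorm L * onorm M" "cmod (l j * m i) \<le> onorm L * onorm M"
        using le that pos by (auto simp: norm_mult intro!: mult_mono)
      then show ?thesis
        using norm_triangle_ineq[of "l i * m j" "l j * m i"] by (simp add: sym_ev_def norm_divide)
    qed
  qed (simp add: pos)
  \<comment> \<open>The quotient at the zero vector is 0.\<close>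
  have "0 \<le> N"
    using sym_onorm_quotient_le[OF zero_in_sym_power] by (simp add: N_def)
  have *: "(sqrt 2 - 1) * (cmod (l i) * cmod (m j)) \<le> N" if "i \<in> I" "j \<in> I" for i j
  proof -
    have N: "cmod (l i) * cmod (m i) \<le> N" "cmod (l j) * cmod (m j) \<le> N"
      "cmod (l i * m j + l j * m i) / 2 \<le> N"
      using sym_onorm_ge[of i i] sym_onorm_ge[of j j] sym_onorm_ge[of i j] that
      by (simp_all add: N_def sym_ev_def norm_mult norm_divide)
    define s r where "s = cmod (l i) * cmod (m j)" and "r = cmod (l j) * cmod (m i)"
    have nn: "0 \<le> s" "0 \<le> N"
      using \<open>0 \<le> N\<close> by (simp_all add: s_def)
    have "s - r \<le> 2 * N"
      using N(3) norm_diff_ineq[of "l i * m j" "l j * m i"] by (simp add: s_def r_def norm_mult)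
    moreover have "s * r = (cmod (l i) * cmod (m i)) * (cmod (l j) * cmod (m j))"
      by (simp add: s_def r_def)
    then have "s * r \<le> N * N"
      using mult_mono[OF N(1,2)] nn by simp
    moreover have "s * (s - r) \<le> s * (2 * N)"
      using nn \<open>s - r \<le> 2 * N\<close> by (intro mult_left_mono)
    \<comment> \<open>Here \<open>s * s = s * (s - r) + s * r\<close>, which is at most
      \<open>2 * N * s + N * N\<close>; adding \<open>s * s\<close> completes the square.\<close>
    ultimately have "2 * s\<^sup>2 \<le> (N + s)\<^sup>2"
      by (simp add: power2_eq_square algebra_simps)
    then have "sqrt (2 * s\<^sup>2) \<le> N + s"
      using nn by (intro real_le_lsqrt) auto
    then show ?thesis
      using nn by (simp add: real_sqrt_mult s_def[symmetric] algebra_simps)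
  qed
  have k: "0 < sqrt 2 - 1"
    by simp
  \<comment> \<open>The estimate \<open>*\<close> bounds every eigenvalue of \<open>L\<close> for
    fixed \<open>j\<close>, hence \<open>onorm L\<close>. The bound divides by
    \<open>cmod (m j)\<close>, so zero is treated separately; the same passage for \<open>M\<close>
    then follows.\<close>
  have **: "(sqrt 2 - 1) * onorm L * cmod (m j) \<le> N" if "j \<in> I" for j
  proof (cases "m j = 0")
    case False
    have "onorm L \<le> N / ((sqrt 2 - 1) * cmod (m j))"
      using *[OF _ that] k False \<open>0 \<le> N\<close>
      by (intro diagonal_onorm_le[OF onb L]) (auto simp: pos_le_divide_eq mult_ac)
    then show ?thesis
      using k False by (simp add: pos_le_divide_eq mult_ac)
  qed (simp add: \<open>0 \<le> N\<close>)
  show "(sqrt 2 - 1) * onorm L * onorm M \<le> N"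
  proof (cases "onorm L = 0")
    case False
    then have "0 < (sqrt 2 - 1) * onorm L"
      using k pos by simp
    moreover from this have "onorm M \<le> N / ((sqrt 2 - 1) * onorm L)"
      using ** \<open>0 \<le> N\<close>
      by (intro diagonal_onorm_le[OF onb M]) (auto simp: pos_le_divide_eq mult_ac)
    ultimately show ?thesis
      by (simp add: pos_le_divide_eq mult_ac)
  qed (simp add: \<open>0 \<le> N\<close>)
qed

end

subsection \<open>Sharpness on a two-dimensional space\<close>

lemma countable_onb_onb: "countable_onb I e \<Longrightarrow> onb I e"
  by (simp add: countable_onb_def onb_def)

text \<open>The outer product of two vectors, without conjugation so that it is linear in both
  arguments.\<close>

definition vec_tensor :: "complex^'n::finite \<Rightarrow> complex^'n \<Rightarrow> complex^'n^'n"
  where "vec_tensor u v = (\<chi> i. (u $ i) *\<^sub>C v)"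

text \<open>A matrix is the sum over its rows of a unit vector tensored with the row, so the
  algebraic span is already the whole space.\<close>

lemma hilbert_tensor_vec: "hilbert_tensor (vec_tensor :: complex^'n::finite \<Rightarrow> _)"
proof -
  have "x \<in> cspan {vec_tensor u v | u v. True}" for x :: "complex^'n^'n"
  proof -
    have "x = (\<Sum>i\<in>UNIV. vec_tensor (axis i 1) (x $ i))"
      by (simp add: vec_eq_iff vec_tensor_def scaleC_vec_def scaleC_complex_def axis_def
          if_distrib[of "\<lambda>c. c * _"] cong: if_cong)
    also have "\<dots> \<in> cspan {vec_tensor u v | u v. True}"
      by (intro complex_space.span_sum complex_space.span_base) blast
    finally show ?thesis .
  qed
  then have "cspan {vec_tensor u v :: complex^'n^'n | u v. True} = UNIV"
    by blast
  moreover have "cinner (vec_tensor u v) (vec_tensor u' v') = cinner u u' * cinner v v'"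
    for u v u' v' :: "complex^'n"
    by (simp add: cinner_vec_def[where 'a = "complex^'n"] cinner_vec_def[of u u']
        vec_tensor_def cinner_scaleC_left cinner_scaleC_right sum_distrib_left
        cinner_complex_def mult_ac)
  ultimately show ?thesis
    unfolding hilbert_tensor_def
    by (simp add: vec_eq_iff vec_tensor_def scaleC_vec_def scaleC_complex_def algebra_simps)
qed

text \<open>Serves for the basis and for the eigenvalues, with indices starting at 1. Since every
  index other than 1 acts like 2, the eigenvalue equation for \<open>diag2\<close> holds at all
  indices.\<close>

definition pair_seq :: "'a \<Rightarrow> 'a \<Rightarrow> nat \<Rightarrow> 'a"
  where "pair_seq a b i = (if i = 1 then a else b)"

definition diag2 :: "complex \<Rightarrow> complex \<Rightarrow> complex^2 \<Rightarrow> complex^2"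
  where "diag2 a b x = vector [a * x $ 1, b * x $ 2]"

abbreviation e2 :: "nat \<Rightarrow> complex^2"
  where "e2 \<equiv> pair_seq (axis 1 1) (axis 2 1)"

lemma countable_onb_e2: "countable_onb {1..2} e2"
proof -
  have "x \<in> cspan (e2 ` {1..2})" for x
  proof -
    have "x = (x $ 1) *\<^sub>C e2 1 + (x $ 2) *\<^sub>C e2 2"
      by (simp add: vec_eq_iff forall_2 pair_seq_def scaleC_vec_def scaleC_complex_def axis_def)
    also have "\<dots> \<in> cspan (e2 ` {1..2})"
      by (intro complex_space.span_add complex_space.span_scale complex_space.span_base) auto
    finally show ?thesis .
  qed
  then have "cspan (e2 ` {1..2}) = UNIV"
    by blast
  moreover have "cinner (e2 i) (e2 j) = (if i = j then 1 else 0)" if "i \<in> {1..2}" "j \<in> {1..2}" for i j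
    using that
    by (auto simp: pair_seq_def cinner_vec_def sum_2 axis_def cinner_complex_def)
  ultimately show ?thesis
    by (auto simp: countable_onb_def)
qed

lemma diagonal_op_diag2: "diagonal_op {1..2} e2 (pair_seq a b) (diag2 a b)"
proof -
  have "diag2 a b (x + y) = diag2 a b x + diag2 a b y"
    and scale: "diag2 a b (c *\<^sub>C x) = c *\<^sub>C diag2 a b x" for x y c
    by (simp_all add: diag2_def vec_eq_iff forall_2 scaleC_vec_def scaleC_complex_def algebra_simps)
  then have "linear (diag2 a b)"
    by (intro linearI) (auto simp: scaleR_scaleC)
  \<comment> \<open>Linear maps on a finite-dimensional space are bounded.\<close>
  then have "bounded_linear (diag2 a b)"
    by (simp add: linear_conv_bounded_linear)
  moreover have "diag2 a b (e2 i) = pair_seq a b i *\<^sub>C e2 i" for i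
    by (simp add: diag2_def vec_eq_iff forall_2 pair_seq_def scaleC_vec_def scaleC_complex_def axis_def)
  ultimately show ?thesis
    by (simp add: diagonal_op_def bounded_clinear_def scale)
qed

lemma onorm_diag2: "onorm (diag2 a b) = max (cmod a) (cmod b)"
proof (rule antisym)
  have onb: "onb {1..2} e2"
    by (rule countable_onb_onb[OF countable_onb_e2])
  have D: "bounded_clinear (diag2 a b)"
    "\<And>i. i \<in> {1..2} \<Longrightarrow> diag2 a b (e2 i) = pair_seq a b i *\<^sub>C e2 i"
    using diagonal_op_diag2 by (auto simp: diagonal_op_def)
  show "onorm (diag2 a b) \<le> max (cmod a) (cmod b)"
    by (rule diagonal_onorm_le[OF onb D]) (auto simp: pair_seq_def max.coboundedI1)
  show "max (cmod a) (cmod b) \<le> onorm (diag2 a b)"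
    using diagonal_onorm_ge[OF onb D(1) D(2)[of 1]] diagonal_onorm_ge[OF onb D(1) D(2)[of 2]]
    by (simp add: pair_seq_def)
qed

lemma diag2_nonzero: "diag2 a b \<noteq> (\<lambda>x. 0)" if "a \<noteq> 0 \<or> b \<noteq> 0"
  using onorm_diag2[of a b] that by (auto simp: onorm_zero max_def split: if_splits)

lemma diagonal_pair_ops:
  assumes "hilbert_tensor t" "countable_onb I e" "diagonal_op I e l L" "diagonal_op I e m M"
  shows "diagonal_pair t I e L M l m"
  by unfold_locales (use assms countable_onb_onb in \<open>auto simp: diagonal_op_def\<close>)

lemmas diagonal_pair_diag2 =
  diagonal_pair_ops[OF hilbert_tensor_vec countable_onb_e2 diagonal_op_diag2 diagonal_op_diag2]

text \<open>The eigenvalues at \<open>(1, 1)\<close>, \<open>(2, 2)\<close> and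
  \<open>(1, 2)\<close> are \<open>s\<close>, \<open>- s\<close> and \<open>(1 - s * s) / 2\<close>.
  As \<open>s\<close> is the positive root of \<open>s * s + 2 * s = 1\<close>, all have modulus
  \<open>s\<close>, while both factors have norm 1.\<close>

lemma lower_bound_attained:
  defines "s \<equiv> sqrt 2 - 1"
  defines "L \<equiv> diag2 1 (- complex_of_real s)" and "M \<equiv> diag2 (complex_of_real s) 1"
  shows "(sqrt 2 - 1) * onorm L * onorm M = onorm_on (sym_power vec_tensor) (sym_tensor_op vec_tensor L M)"
proof -
  interpret diagonal_pair vec_tensor "{1..2}" e2 L M
    "pair_seq 1 (- complex_of_real s)" "pair_seq (complex_of_real s) 1"
    unfolding L_def M_def by (rule diagonal_pair_diag2)
  have s: "0 \<le> s" "s \<le> 1"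
    using real_sqrt_le_mono[of 2 4] by (simp_all add: s_def)
  have "(1 - s * s) / 2 = s"
    by (simp add: s_def field_simps)
  then have s2: "(1 - complex_of_real s * complex_of_real s) / 2 = complex_of_real s"
    by (metis of_real_1 of_real_diff of_real_divide of_real_mult of_real_numeral)
  have "onorm L = 1" "onorm M = 1"
    using s by (simp_all add: L_def M_def onorm_diag2)
  moreover have "onorm_on (sym_power vec_tensor) (sym_tensor_op vec_tensor L M) \<le> s"
  proof (rule sym_onorm_le)
    show "cmod (sym_ev i j) \<le> s" if "i \<in> {1..2}" "j \<in> {1..2}" for i j
      using s s2 by (auto simp: sym_ev_def pair_seq_def)
  qed (rule s)
  ultimately show ?thesis
    using sym_onorm_bounds(1) by (simp add: s_def)
qed

text \<open>Both factors are the identity, whose symmetric square has eigenvalue 1; the reverse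
  inequality is the general upper bound.\<close>

lemma upper_bound_attained:
  "onorm_on (sym_power vec_tensor) (sym_tensor_op vec_tensor (diag2 1 1) (diag2 1 1)) =
    onorm (diag2 1 1) * onorm (diag2 1 1)"
proof -
  interpret diagonal_pair vec_tensor "{1..2}" e2 "diag2 1 1" "diag2 1 1" "pair_seq 1 1" "pair_seq 1 1"
    by (rule diagonal_pair_diag2)
  show ?thesis
    using sym_onorm_bounds(2) sym_onorm_ge[of 1 1] by (simp add: onorm_diag2 sym_ev_def pair_seq_def)
qed

theorem proposition7p2:
  shows
    "(\<forall>(t :: 'a::complex_hilbert \<Rightarrow> 'a \<Rightarrow> 'k::complex_hilbert) (I :: nat set) (e :: nat \<Rightarrow> 'a)
        (l :: nat \<Rightarrow> complex) (m :: nat \<Rightarrow> complex) (L :: 'a \<Rightarrow> 'a) (M :: 'a \<Rightarrow> 'a).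
        hilbert_tensor t \<and> countable_onb I e \<and> diagonal_op I e l L \<and> diagonal_op I e m M \<longrightarrow>
          (sqrt 2 - 1) * onorm L * onorm M \<le> onorm_on (sym_power t) (sym_tensor_op t L M) \<and>
          onorm_on (sym_power t) (sym_tensor_op t L M) \<le> onorm L * onorm M)
     \<and> (\<exists>(t :: complex^2 \<Rightarrow> complex^2 \<Rightarrow> complex^2^2) (I :: nat set) (e :: nat \<Rightarrow> complex^2)
        (l :: nat \<Rightarrow> complex) (m :: nat \<Rightarrow> complex) (L :: complex^2 \<Rightarrow> complex^2) (M :: complex^2 \<Rightarrow> complex^2).
        hilbert_tensor t \<and> countable_onb I e \<and> diagonal_op I e l L \<and> diagonal_op I e m M \<and>
        L \<noteq> (\<lambda>x. 0) \<and> M \<noteq> (\<lambda>x. 0) \<and>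
          (sqrt 2 - 1) * onorm L * onorm M = onorm_on (sym_power t) (sym_tensor_op t L M))
     \<and> (\<exists>(t :: complex^2 \<Rightarrow> complex^2 \<Rightarrow> complex^2^2) (I :: nat set) (e :: nat \<Rightarrow> complex^2)
        (l :: nat \<Rightarrow> complex) (m :: nat \<Rightarrow> complex) (L :: complex^2 \<Rightarrow> complex^2) (M :: complex^2 \<Rightarrow> complex^2).
        hilbert_tensor t \<and> countable_onb I e \<and> diagonal_op I e l L \<and> diagonal_op I e m M \<and>
        L \<noteq> (\<lambda>x. 0) \<and> M \<noteq> (\<lambda>x. 0) \<and>
          onorm_on (sym_power t) (sym_tensor_op t L M) = onorm L * onorm M)"
proof (intro conjI allI impI)
  fix t :: "'a \<Rightarrow> 'a \<Rightarrow> 'k" and I :: "nat set" and e :: "nat \<Rightarrow> 'a" and l m :: "nat \<Rightarrow> complex"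
    and L M :: "'a \<Rightarrow> 'a"
  assume "hilbert_tensor t \<and> countable_onb I e \<and> diagonal_op I e l L \<and> diagonal_op I e m M"
  then interpret diagonal_pair t I e L M l m
    by (intro diagonal_pair_ops) auto
  show "(sqrt 2 - 1) * onorm L * onorm M \<le> onorm_on (sym_power t) (sym_tensor_op t L M)"
    and "onorm_on (sym_power t) (sym_tensor_op t L M) \<le> onorm L * onorm M"
    by (rule sym_onorm_bounds)+
next
  show "\<exists>(t :: complex^2 \<Rightarrow> complex^2 \<Rightarrow> complex^2^2) (I :: nat set) (e :: nat \<Rightarrow> complex^2)
        (l :: nat \<Rightarrow> complex) (m :: nat \<Rightarrow> complex) (L :: complex^2 \<Rightarrow> complex^2) (M :: complex^2 \<Rightarrow> complex^2).
        hilbert_tensor t \<and> countable_onb I e \<and> diagonal_op I e l L \<and> diagonal_op I e m M \<and>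
        L \<noteq> (\<lambda>x. 0) \<and> M \<noteq> (\<lambda>x. 0) \<and>
          (sqrt 2 - 1) * onorm L * onorm M = onorm_on (sym_power t) (sym_tensor_op t L M)"
    by (rule exI[of _ vec_tensor], rule exI[of _ "{1..2}"], rule exI[of _ e2],
        rule exI[of _ "pair_seq 1 (- complex_of_real (sqrt 2 - 1))"],
        rule exI[of _ "pair_seq (complex_of_real (sqrt 2 - 1)) 1"],
        rule exI[of _ "diag2 1 (- complex_of_real (sqrt 2 - 1))"],
        rule exI[of _ "diag2 (complex_of_real (sqrt 2 - 1)) 1"])
      (intro conjI hilbert_tensor_vec countable_onb_e2 diagonal_op_diag2 diag2_nonzero
        lower_bound_attained; simp)
next
  show "\<exists>(t :: complex^2 \<Rightarrow> complex^2 \<Rightarrow> complex^2^2) (I :: nat set) (e :: nat \<Rightarrow> complex^2)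
        (l :: nat \<Rightarrow> complex) (m :: nat \<Rightarrow> complex) (L :: complex^2 \<Rightarrow> complex^2) (M :: complex^2 \<Rightarrow> complex^2).
        hilbert_tensor t \<and> countable_onb I e \<and> diagonal_op I e l L \<and> diagonal_op I e m M \<and>
        L \<noteq> (\<lambda>x. 0) \<and> M \<noteq> (\<lambda>x. 0) \<and>
          onorm_on (sym_power t) (sym_tensor_op t L M) = onorm L * onorm M"
    by (rule exI[of _ vec_tensor], rule exI[of _ "{1..2}"], rule exI[of _ e2],
        rule exI[of _ "pair_seq 1 1"], rule exI[of _ "pair_seq 1 1"],
        rule exI[of _ "diag2 1 1"], rule exI[of _ "diag2 1 1"])
      (intro conjI hilbert_tensor_vec countable_onb_e2 diagonal_op_diag2 diag2_nonzero
        upper_bound_attained; simp)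
qed

end
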